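(* Let $\mathfrak{X}$ be a class of groups that is closed under taking quotients and direct products, and let the (not necessarily finite) group $G=NH$ be the product of subgroups $N$ and $H$ with $N\trianglelefteq G$ and $N\cap H\le Z(N)$. Suppose that $N$ and $H$ are both $\mathfrak{X}\mathrm{YB}$-groups with, respectively, associated skew left braces of $\mathfrak{X}$-type $(N,+,\cdot)$ and $(H,+,\cdot)$ satisfying the following conditions: \begin{enumerate} \item $N\cap H\le \mathrm{Ker}(N)\cap\mathrm{Ker}(H)$; \item $(N\cap H,+)\le Z(N,+)\cap Z(H,+)$; \item the action of $H$ on $N$ by conjugation in $G$ is equivariant. \end{enumerate} Then $G$ is an $\mathfrak{X}\mathrm{YB}$-group, with an associated skew left brace $(G,+,\cdot)$ of $\mathfrak{X}$-type such that $\mathrm{Soc}(N)\,C_{\mathrm{Soc}(H)}(N)\subseteq \mathrm{Soc}(G)$. Furthermore, the associated skew left braces $(N,+,\cdot)$ and $(H,+,\cdot)$ are subbraces of the associated skew left brace $(G,+,\cdot)$.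
   Context: Groups here are not assumed finite. A skew left brace is a triple $(B,+,\cdot)$ where $(B,+)$ (not necessarily abelian) and $(B,\cdot)$ are groups with $a\cdot(b+c)=a\cdot b-a+a\cdot c$ for all $a,b,c\in B$. It is of $\mathfrak{X}$-type if $(B,+)$ belongs to $\mathfrak{X}$. A group is an $\mathfrak{X}\mathrm{YB}$-group if it is isomorphic to the multiplicative group of a skew left brace of $\mathfrak{X}$-type; equivalently, an addition $+$ can be defined on the group $(G,\cdot)$ so that $(G,+,\cdot)$ is a skew left brace of $\mathfrak{X}$-type, called an associated skew left brace of $G$ (the group operation of $G$ being the multiplication). For a skew left brace $B$ and $a\in B$, put $\lambda_a(b)=-a+ab$; then $\lambda:(B,\cdot)\to\mathrm{Aut}(B,+)$, $a\mapsto\lambda_a$, is a homomorphism. Set $\mathrm{Ker}(B)=\ker\lambda$ and $\mathrm{Soc}(B)=\mathrm{Ker}(B)\cap Z(B,+)=\{a\in B\mid ab=a+b=b+a\ \forall b\in B\}$. Here $Z(N)$ is the centre of the multiplicative group $N$, $Z(N,+)$ and $Z(H,+)$ are the centres of the additive groups, and $C_{\mathrm{Soc}(H)}(N)$ is the set of elements of $\mathrm{Soc}(H)$ commuting in $G$ with every element of $N$. An action of a group $A$ on an $\mathfrak{X}\mathrm{YB}$-group $(G,\cdot)$ with associated skew left brace $(G,+,\cdot)$ is equivariant if each element of $A$ acts by automorphisms of both $(G,+)$ and $(G,\cdot)$, i.e. $a\cdot(g+h)=a\cdot g+a\cdot h$ and $a\cdot(gh)=(a\cdot g)(a\cdot h)$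 for all $a\in A$, $g,h\in G$. A subbrace is a subset that is a subgroup of both the additive and the multiplicative groups, with the induced operations. *)

theory Defs
  imports "HOL-Algebra.Algebra"
begin

text \<open>
  HOL cannot quantify over classes of groups ranging over all types.  A class of groups is
  therefore given by a predicate \<open>\<XX>\<close> on groups whose carriers live in a universe type
  \<open>'u\<close>, and a group over any other type belongs to the class if it is isomorphic to a
  member of \<open>\<XX>\<close>.  When \<open>'u\<close> is infinite, all quotients and binary direct
  products of members of \<open>\<XX>\<close> have isomorphic copies over \<open>'u\<close>.
\<close>

definition group_class :: "('u monoid \<Rightarrow> bool) \<Rightarrow> bool" where
  "group_class \<XX> \<longleftrightarrow>
     (\<forall>A. \<XX> A \<longrightarrow> group A) \<and>
     (\<forall>A C. \<XX> A \<longrightarrow> group C \<longrightarrow> C \<cong> A \<longrightarrow> \<XX> C)"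

definition quotient_closed :: "('u monoid \<Rightarrow> bool) \<Rightarrow> bool" where
  "quotient_closed \<XX> \<longleftrightarrow>
     (\<forall>A K C. \<XX> A \<longrightarrow> K \<lhd> A \<longrightarrow> group C \<longrightarrow> C \<cong> A Mod K \<longrightarrow> \<XX> C)"

definition product_closed :: "('u monoid \<Rightarrow> bool) \<Rightarrow> bool" where
  "product_closed \<XX> \<longleftrightarrow>
     (\<forall>A B C. \<XX> A \<longrightarrow> \<XX> B \<longrightarrow> group C \<longrightarrow> C \<cong> A \<times>\<times> B \<longrightarrow> \<XX> C)"

definition in_class :: "('u monoid \<Rightarrow> bool) \<Rightarrow> ('a, 'm) monoid_scheme \<Rightarrow> bool" where
  "in_class \<XX> G \<longleftrightarrow> group G \<and> (\<exists>U. \<XX> U \<and> G \<cong> U)"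

definition centralizer ::
    "('a, 'm) monoid_scheme \<Rightarrow> 'a set \<Rightarrow> 'a set \<Rightarrow> 'a set" where
  "centralizer G S T = {x \<in> S. \<forall>y\<in>T. x \<otimes>\<^bsub>G\<^esub> y = y \<otimes>\<^bsub>G\<^esub> x}"

definition center :: "('a, 'm) monoid_scheme \<Rightarrow> 'a set" where
  "center G = centralizer G (carrier G) (carrier G)"

text \<open>
  The ring record only supplies the two operations on a common carrier; the additive group
  \<open>add_monoid B\<close> need not be abelian, and the multiplicative group is \<open>B\<close> itself,
  viewed as a monoid record.
\<close>

locale skew_left_brace =
  fixes B :: "('a, 'm) ring_scheme" (structure)
  assumes add_group: "group (add_monoid B)"
    and mult_group: "group B"
    and brace_distrib:
      "\<lbrakk>a \<in> carrier B; b \<in> carrier B; c \<in> carrier B\<rbrakk> \<Longrightarrow>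
         a \<otimes> (b \<oplus> c) = (a \<otimes> b \<oplus> (\<ominus> a)) \<oplus> a \<otimes> c"

definition brace_of_type :: "('u monoid \<Rightarrow> bool) \<Rightarrow> ('a, 'm) ring_scheme \<Rightarrow> bool" where
  "brace_of_type \<XX> B \<longleftrightarrow> skew_left_brace B \<and> in_class \<XX> (add_monoid B)"

definition XYB_group :: "('u monoid \<Rightarrow> bool) \<Rightarrow> ('a, 'm) monoid_scheme \<Rightarrow> bool" where
  "XYB_group \<XX> G \<longleftrightarrow> group G \<and> (\<exists>B :: 'a ring. brace_of_type \<XX> B \<and> G \<cong> B)"

definition associated_brace ::
    "('u monoid \<Rightarrow> bool) \<Rightarrow> ('a, 'm) monoid_scheme \<Rightarrow> 'a ring \<Rightarrow> bool" where
  "associated_brace \<XX> G B \<longleftrightarrow>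
     brace_of_type \<XX> B \<and> carrier B = carrier G \<and>
     (\<forall>x\<in>carrier G. \<forall>y\<in>carrier G. x \<otimes>\<^bsub>B\<^esub> y = x \<otimes>\<^bsub>G\<^esub> y)"

lemma associated_brace_imp_XYB_group:
  assumes "group G" "associated_brace \<XX> G B"
  shows "XYB_group \<XX> G"
proof -
  have "id \<in> iso G B"
    using assms(2) group.is_monoid[OF assms(1)]
    by (auto simp: associated_brace_def iso_def hom_def)
  then show ?thesis
    using assms unfolding XYB_group_def is_iso_def associated_brace_def by blast
qed

definition brace_lambda :: "('a, 'm) ring_scheme \<Rightarrow> 'a \<Rightarrow> 'a \<Rightarrow> 'a" where
  "brace_lambda B a = (\<lambda>b\<in>carrier B. \<ominus>\<^bsub>B\<^esub> a \<oplus>\<^bsub>B\<^esub> a \<otimes>\<^bsub>B\<^esub> b)"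

definition brace_ker :: "('a, 'm) ring_scheme \<Rightarrow> 'a set" where
  "brace_ker B = kernel B (AutoGroup (add_monoid B)) (brace_lambda B)"

definition brace_soc :: "('a, 'm) ring_scheme \<Rightarrow> 'a set" where
  "brace_soc B = brace_ker B \<inter> center (add_monoid B)"

definition equivariant_action ::
    "('g, 'm) monoid_scheme \<Rightarrow> ('a, 'n) ring_scheme \<Rightarrow> ('g \<Rightarrow> 'a \<Rightarrow> 'a) \<Rightarrow> bool" where
  "equivariant_action A B \<phi> \<longleftrightarrow>
     group_action A (carrier B) \<phi> \<and>
     (\<forall>a\<in>carrier A. \<phi> a \<in> auto (add_monoid B) \<and> \<phi> a \<in> auto B)"

definition conj_action :: "('a, 'm) monoid_scheme \<Rightarrow> 'a set \<Rightarrow> 'a \<Rightarrow> 'a \<Rightarrow> 'a" where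
  "conj_action G N h = (\<lambda>n\<in>N. h \<otimes>\<^bsub>G\<^esub> n \<otimes>\<^bsub>G\<^esub> inv\<^bsub>G\<^esub> h)"

text \<open>The brace \<open>C\<close>, with its own operations, is a subbrace of \<open>B\<close>.\<close>

definition is_subbrace :: "('a, 'm) ring_scheme \<Rightarrow> ('a, 'n) ring_scheme \<Rightarrow> bool" where
  "is_subbrace C B \<longleftrightarrow>
     subgroup (carrier C) (add_monoid B) \<and> subgroup (carrier C) B \<and>
     (\<forall>x\<in>carrier C. \<forall>y\<in>carrier C.
        x \<oplus>\<^bsub>C\<^esub> y = x \<oplus>\<^bsub>B\<^esub> y \<and> x \<otimes>\<^bsub>C\<^esub> y = x \<otimes>\<^bsub>B\<^esub> y)"

end

theory Submission
  imports Defs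
begin

text \<open>
  Since \<open>G = NH\<close>, an addition on \<open>G\<close> is forced to be
  \<open>nh + mk = (n + m)(h + k)\<close> if it is to make \<open>N\<close> and \<open>H\<close> subbraces whose elements commute
  additively and satisfy \<open>nh = n + h\<close>.  The only question is whether this makes sense, because
  a factorisation \<open>nh\<close> can be changed to \<open>(nz)(z\<inverse>h)\<close> with \<open>z \<in> N \<inter> H\<close>.  For such \<open>z\<close> the
  hypotheses on kernels and additive centres make left multiplication by \<open>z\<close> and addition of \<open>z\<close>
  on either side the same operation, in both braces, and \<open>z\<close> also commutes with \<open>N\<close> in \<open>G\<close>.
  So \<open>z\<close> can be moved out of each sum, and then cancels (\<open>summand_product_unique\<close>).

  Three observations then finish the argument.
  First, \<open>(n, h) \<mapsto> nh\<close> is a homomorphism from \<open>(N, +) \<times> (H, +)\<close> onto \<open>(G, +)\<close>; hence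
  \<open>(G, +)\<close> is a group, and it belongs to every class closed under products and quotients.
  Secondly, \<open>(nh)(mk) = (n \<cdot> hmh\<inverse>)(hk)\<close>.  As conjugation by \<open>h\<close> respects the addition
  of \<open>N\<close>, the brace law of \<open>G\<close> splits into the brace laws of \<open>N\<close> and \<open>H\<close>
  (\<open>glued_distrib\<close>).
  Thirdly, for \<open>a \<in> Soc(N)\<close> and \<open>c \<in> Soc(H)\<close> centralising \<open>N\<close>, the same formula gives
  \<open>(ac)(mk) = (am)(ck) = (a + m)(c + k)\<close>, so \<open>ac\<close> lies in the socle of \<open>G\<close>.
\<close>

section \<open>Classes of groups closed under quotients and products\<close>

text \<open>
  A class consists of groups over its universe type only, so a homomorphic image has to be copied
  there before it can be recognised as a quotient: choosing one preimage for every element of the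
  image embeds it into a member of the class.
\<close>

lemma in_class_epi_image:
  assumes cls: "group_class \<XX>" "quotient_closed \<XX>" and A: "in_class \<XX> A"
    and f: "f \<in> hom A K" "f ` carrier A = carrier K" and K: "group K"
  shows "in_class \<XX> K"
proof -
  obtain U where U: "\<XX> U" "A \<cong> U" and gA: "group A"
    using A unfolding in_class_def by blast
  have gU: "group U"
    using cls(1) U(1) unfolding group_class_def by blast
  obtain g where g: "g \<in> iso U A"
    using group.iso_sym[OF gA U(2)] unfolding is_iso_def by blast
  define p where "p = f \<circ> g"
  have p: "p \<in> hom U K" "p ` carrier U = carrier K"
    using g f hom_compose[of g U A f K] unfolding p_def iso_iff image_comp[symmetric]
    by simp_all
  interpret p: group_hom U K p
    by (simp add: group_hom.intro group_hom_axioms_def gU K p(1))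
  define s where "s = inv_into (carrier U) p"
  have s: "inj_on s (carrier K)"
    unfolding s_def using p(2) by (simp add: inj_on_inv_into)
  have "K \<cong> image_group s K"
    using inj_imp_image_group_iso[OF s] by (rule is_isoI)
  moreover have "group (image_group s K)"
    using group.inj_imp_image_group_is_group[OF K s] .
  moreover have "U Mod kernel U K p \<cong> K"
    using p.FactGroup_iso[OF p(2)] .
  ultimately have "image_group s K \<cong> U Mod kernel U K p"
    by (meson K group.iso_sym iso_trans normal.factorgroup_is_group p.normal_kernel)
  then have "\<XX> (image_group s K)"
    using cls(2) U(1) p.normal_kernel \<open>group (image_group s K)\<close>
    unfolding quotient_closed_def by blast
  then show ?thesis
    using K \<open>K \<cong> image_group s K\<close> unfolding in_class_def by blast
qed

lemma in_class_DirProd: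
  fixes \<XX> :: "'u monoid \<Rightarrow> bool"
  assumes inf: "infinite (UNIV :: 'u set)"
    and cls: "group_class \<XX>" "product_closed \<XX>"
    and A: "in_class \<XX> A" and B: "in_class \<XX> B"
  shows "in_class \<XX> (A \<times>\<times> B)"
proof -
  obtain U V where U: "\<XX> U" "A \<cong> U" and V: "\<XX> V" "B \<cong> V"
    and gAB: "group A" "group B"
    using A B unfolding in_class_def by blast
  have gUV: "group U" "group V"
    using cls(1) U(1) V(1) unfolding group_class_def by blast+
  \<comment> \<open>An infinite universe admits a pairing function, along which the product is copied.\<close>
  obtain f :: "'u \<times> 'u \<Rightarrow> 'u" where f: "inj f"
    using card_of_Times_same_infinite[OF inf] 
    unfolding card_of_ordIso[symmetric] bij_betw_def by auto
  let ?P = "image_group f (U \<times>\<times> V)"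
  have inj: "inj_on f (carrier (U \<times>\<times> V))"
    using f by (rule inj_on_subset) simp
  have gP: "group ?P"
    using group.inj_imp_image_group_is_group[OF DirProd_group[OF gUV] inj] .
  have iso: "U \<times>\<times> V \<cong> ?P"
    using inj_imp_image_group_iso[OF inj] by (rule is_isoI)
  have "\<XX> ?P"
    using cls(2) U(1) V(1) gP group.iso_sym[OF DirProd_group[OF gUV] iso]
    unfolding product_closed_def by blast
  moreover have "A \<times>\<times> B \<cong> ?P"
    using group.DirProd_iso_trans[OF gAB(1) U(2) V(2)] iso by (rule iso_trans)
  ultimately show ?thesis
    using DirProd_group[OF gAB] unfolding in_class_def by blast
qed

section \<open>Skew left braces\<close>

lemma center_iff:
  "x \<in> center G \<longleftrightarrow> x \<in> carrier G \<and> (\<forall>y\<in>carrier G. x \<otimes>\<^bsub>G\<^esub> y = y \<otimes>\<^bsub>G\<^esub> x)"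
  by (simp add: center_def centralizer_def)

context skew_left_brace
begin

sublocale add: group "add_monoid B"
  rewrites "carrier (add_monoid B) = carrier B"
    and "monoid.mult (add_monoid B) = add B"
    and "one (add_monoid B) = \<zero>"
    and "m_inv (add_monoid B) = a_inv B"
  by (simp_all add: add_group a_inv_def)

sublocale mult: group B
  by (rule mult_group)

lemma zero_eq_one: "\<zero> = \<one>"
proof -
  have "\<one> \<otimes> (\<zero> \<oplus> \<zero>) = (\<one> \<otimes> \<zero> \<oplus> (\<ominus> \<one>)) \<oplus> \<one> \<otimes> \<zero>"
    by (intro brace_distrib) simp_all
  then have "\<ominus> \<one> = \<zero>"
    by simp
  then show ?thesis
    by (metis add.inv_inv add.inv_one mult.one_closed)
qed

lemma brace_ker_iff:
  "a \<in> brace_ker B \<longleftrightarrow> a \<in> carrier B \<and> (\<forall>b\<in>carrier B. a \<otimes> b = a \<oplus> b)"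
proof -
  have "\<ominus> a \<oplus> a \<otimes> b = b \<longleftrightarrow> a \<otimes> b = a \<oplus> b" if "a \<in> carrier B" "b \<in> carrier B" for b
    using that add.inv_solve_left' [of b a "a \<otimes> b"] by auto
  then show ?thesis
    unfolding brace_ker_def kernel_def brace_lambda_def AutoGroup_def BijGroup_def
    by (auto simp: fun_eq_iff restrict_def)
qed

lemma brace_soc_iff:
  "a \<in> brace_soc B \<longleftrightarrow>
     a \<in> carrier B \<and> (\<forall>b\<in>carrier B. a \<otimes> b = a \<oplus> b \<and> a \<oplus> b = b \<oplus> a)"
  unfolding brace_soc_def by (auto simp: brace_ker_iff center_iff)

end


section \<open>Gluing two braces along a common central part\<close>

text \<open>
  The hypotheses on \<open>N \<inter> H\<close> about kernels and additive centres say together that it lies in both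
  socles; this is the form in which they are used.
\<close>

locale central_brace_product = group G
  for G (structure) +
  fixes N H :: "'a set" and BN BH :: "'a ring"
  assumes normal_N: "N \<lhd> G"
    and subgroup_H: "subgroup H G"
    and carrier_eq: "carrier G = N <#> H"
    and brace_N: "skew_left_brace BN" and brace_H: "skew_left_brace BH"
    and carrier_N: "carrier BN = N" and carrier_H: "carrier BH = H"
    and mult_N: "\<lbrakk>x \<in> N; y \<in> N\<rbrakk> \<Longrightarrow> x \<otimes>\<^bsub>BN\<^esub> y = x \<otimes> y"
    and mult_H: "\<lbrakk>x \<in> H; y \<in> H\<rbrakk> \<Longrightarrow> x \<otimes>\<^bsub>BH\<^esub> y = x \<otimes> y"
    and conj_add: "\<lbrakk>h \<in> H; m \<in> N; p \<in> N\<rbrakk> \<Longrightarrow>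
      h \<otimes> (m \<oplus>\<^bsub>BN\<^esub> p) \<otimes> inv h = (h \<otimes> m \<otimes> inv h) \<oplus>\<^bsub>BN\<^esub> (h \<otimes> p \<otimes> inv h)"
    and meet_central: "\<lbrakk>z \<in> N \<inter> H; n \<in> N\<rbrakk> \<Longrightarrow> z \<otimes> n = n \<otimes> z"
    and meet_soc_N: "N \<inter> H \<subseteq> brace_soc BN"
    and meet_soc_H: "N \<inter> H \<subseteq> brace_soc BH"
begin

sublocale BN: skew_left_brace BN
  rewrites "carrier BN = N"
  by (simp_all add: brace_N carrier_N)

sublocale BH: skew_left_brace BH
  rewrites "carrier BH = H"
  by (simp_all add: brace_H carrier_H)

lemma subgroup_N: "subgroup N G"
  using normal_N by (rule normal_imp_subgroup)

lemma N_closed [simp]: "n \<in> N \<Longrightarrow> n \<in> carrier G"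
  and N_mult [simp]: "\<lbrakk>n \<in> N; m \<in> N\<rbrakk> \<Longrightarrow> n \<otimes> m \<in> N"
  and N_inv [simp]: "n \<in> N \<Longrightarrow> inv n \<in> N"
  and N_one [simp]: "\<one> \<in> N"
  using subgroup_N
  by (auto dest: subgroup.mem_carrier subgroup.m_closed subgroup.m_inv_closed subgroup.one_closed)

lemma H_closed [simp]: "h \<in> H \<Longrightarrow> h \<in> carrier G"
  and H_mult [simp]: "\<lbrakk>h \<in> H; k \<in> H\<rbrakk> \<Longrightarrow> h \<otimes> k \<in> H"
  and H_inv [simp]: "h \<in> H \<Longrightarrow> inv h \<in> H"
  and H_one [simp]: "\<one> \<in> H"
  using subgroup_H
  by (auto dest: subgroup.mem_carrier subgroup.m_closed subgroup.m_inv_closed subgroup.one_closed)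

lemma conj_closed [simp]: "\<lbrakk>x \<in> carrier G; n \<in> N\<rbrakk> \<Longrightarrow> x \<otimes> n \<otimes> inv x \<in> N"
  using normal.inv_op_closed2[OF normal_N] by simp

lemma factorisation:
  assumes "x \<in> carrier G"
  obtains n h where "n \<in> N" "h \<in> H" "x = n \<otimes> h"
  using assms unfolding carrier_eq set_mult_def by blast

lemma zero_N: "\<zero>\<^bsub>BN\<^esub> = \<one>" and zero_H: "\<zero>\<^bsub>BH\<^esub> = \<one>"
proof -
  show "\<zero>\<^bsub>BN\<^esub> = \<one>"
    using BN.mult.l_one[of \<one>] BN.mult.one_closed mult_N[of "\<one>\<^bsub>BN\<^esub>" \<one>]
    by (simp add: BN.zero_eq_one)
  show "\<zero>\<^bsub>BH\<^esub> = \<one>"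
    using BH.mult.l_one[of \<one>] BH.mult.one_closed mult_H[of "\<one>\<^bsub>BH\<^esub>" \<one>]
    by (simp add: BH.zero_eq_one)
qed

lemma brace_law_N:
  "\<lbrakk>n \<in> N; m \<in> N; p \<in> N\<rbrakk> \<Longrightarrow>
    n \<otimes> (m \<oplus>\<^bsub>BN\<^esub> p) = (n \<otimes> m \<oplus>\<^bsub>BN\<^esub> (\<ominus>\<^bsub>BN\<^esub> n)) \<oplus>\<^bsub>BN\<^esub> n \<otimes> p"
  using BN.brace_distrib[of n m p] by (simp add: mult_N)

lemma brace_law_H:
  "\<lbrakk>h \<in> H; k \<in> H; l \<in> H\<rbrakk> \<Longrightarrow>
    h \<otimes> (k \<oplus>\<^bsub>BH\<^esub> l) = (h \<otimes> k \<oplus>\<^bsub>BH\<^esub> (\<ominus>\<^bsub>BH\<^esub> h)) \<oplus>\<^bsub>BH\<^esub> h \<otimes> l"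
  using BH.brace_distrib[of h k l] by (simp add: mult_H)

lemma soc_N_iff:
  "a \<in> brace_soc BN \<longleftrightarrow>
     a \<in> N \<and> (\<forall>n\<in>N. a \<otimes> n = a \<oplus>\<^bsub>BN\<^esub> n \<and> a \<oplus>\<^bsub>BN\<^esub> n = n \<oplus>\<^bsub>BN\<^esub> a)"
  by (simp add: BN.brace_soc_iff mult_N cong: conj_cong ball_cong)

lemma soc_H_iff:
  "a \<in> brace_soc BH \<longleftrightarrow>
     a \<in> H \<and> (\<forall>h\<in>H. a \<otimes> h = a \<oplus>\<^bsub>BH\<^esub> h \<and> a \<oplus>\<^bsub>BH\<^esub> h = h \<oplus>\<^bsub>BH\<^esub> a)"
  by (simp add: BH.brace_soc_iff mult_H cong: conj_cong ball_cong)

text \<open>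
  Left multiplication by an element \<open>z\<close> of \<open>N \<inter> H\<close> is addition of \<open>z\<close>, on either side, so a
  factor \<open>z\<close> of a summand moves out of the sum.  In \<open>N\<close>, where \<open>zn = nz\<close>, it is moved out to
  the right, and in \<open>H\<close> to the left, so that the two can meet in the middle of a product \<open>nh\<close>.
\<close>

lemma meet_pull_N:
  assumes z: "z \<in> N \<inter> H" and n: "n \<in> N" "m \<in> N"
  shows "(n \<otimes> z) \<oplus>\<^bsub>BN\<^esub> m = (n \<oplus>\<^bsub>BN\<^esub> m) \<otimes> z"
    and "n \<oplus>\<^bsub>BN\<^esub> (m \<otimes> z) = (n \<oplus>\<^bsub>BN\<^esub> m) \<otimes> z"
proof -
  have shift: "p \<otimes> z = z \<oplus>\<^bsub>BN\<^esub> p" "z \<oplus>\<^bsub>BN\<^esub> p = p \<oplus>\<^bsub>BN\<^esub> z" if "p \<in> N" for p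
    using that meet_central[OF z that] subsetD[OF meet_soc_N z] unfolding soc_N_iff by metis+
  have zN: "z \<in> N"
    using z by simp
  show "(n \<otimes> z) \<oplus>\<^bsub>BN\<^esub> m = (n \<oplus>\<^bsub>BN\<^esub> m) \<otimes> z"
    using n zN by (simp add: shift(1) BN.add.m_assoc)
  show "n \<oplus>\<^bsub>BN\<^esub> (m \<otimes> z) = (n \<oplus>\<^bsub>BN\<^esub> m) \<otimes> z"
    using n zN by (simp add: shift BN.add.m_assoc)
qed

lemma meet_pull_H:
  assumes z: "z \<in> N \<inter> H" and h: "h \<in> H" "k \<in> H"
  shows "(z \<otimes> h) \<oplus>\<^bsub>BH\<^esub> k = z \<otimes> (h \<oplus>\<^bsub>BH\<^esub> k)"
    and "h \<oplus>\<^bsub>BH\<^esub> (z \<otimes> k) = z \<otimes> (h \<oplus>\<^bsub>BH\<^esub> k)"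
proof -
  have shift: "z \<otimes> p = z \<oplus>\<^bsub>BH\<^esub> p" "z \<oplus>\<^bsub>BH\<^esub> p = p \<oplus>\<^bsub>BH\<^esub> z" if "p \<in> H" for p
    using that subsetD[OF meet_soc_H z] unfolding soc_H_iff by metis+
  have zH: "z \<in> H"
    using z by simp
  show "(z \<otimes> h) \<oplus>\<^bsub>BH\<^esub> k = z \<otimes> (h \<oplus>\<^bsub>BH\<^esub> k)"
    using h zH by (simp add: shift(1) BH.add.m_assoc)
  show "h \<oplus>\<^bsub>BH\<^esub> (z \<otimes> k) = z \<otimes> (h \<oplus>\<^bsub>BH\<^esub> k)"
    using h zH by (simp add: shift BH.add.m_assoc)
qed

lemma factorisation_change:
  assumes "n \<in> N" "h \<in> H" "n' \<in> N" "h' \<in> H" and eq: "n \<otimes> h = n' \<otimes> h'"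
  obtains z where "z \<in> N \<inter> H" "n' = n \<otimes> z" "h = z \<otimes> h'"
proof
  let ?z = "inv n \<otimes> n'"
  show h: "h = ?z \<otimes> h'"
    using assms(1-4) by (simp add: m_assoc eq[symmetric]) (simp add: m_assoc[symmetric])
  then have "h \<otimes> inv h' = ?z"
    using assms(1-4) by (simp add: inv_solve_right')
  then have "?z \<in> H"
    using assms(2,4) by (metis H_inv H_mult)
  then show "?z \<in> N \<inter> H"
    using assms(1,3) by simp
  show "n' = n \<otimes> ?z"
    using assms(1,3) by (simp add: m_assoc[symmetric])
qed

text \<open>
  The addition on \<open>G\<close> is well defined: both sides equal \<open>(n + m) \<cdot> w \<cdot> z \<cdot> (h' + k')\<close>, where
  \<open>z\<close> and \<open>w\<close> in \<open>N \<inter> H\<close> are the elements by which the two pairs of factorisations differ.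
\<close>

lemma summand_product_unique:
  assumes N: "n \<in> N" "m \<in> N" "n' \<in> N" "m' \<in> N" and H: "h \<in> H" "k \<in> H" "h' \<in> H" "k' \<in> H"
    and eq: "n \<otimes> h = n' \<otimes> h'" "m \<otimes> k = m' \<otimes> k'"
  shows "(n \<oplus>\<^bsub>BN\<^esub> m) \<otimes> (h \<oplus>\<^bsub>BH\<^esub> k) = (n' \<oplus>\<^bsub>BN\<^esub> m') \<otimes> (h' \<oplus>\<^bsub>BH\<^esub> k')"
proof -
  obtain z where z: "z \<in> N \<inter> H" "n' = n \<otimes> z" "h = z \<otimes> h'"
    using factorisation_change[of n h n' h'] assms by blast
  obtain w where w: "w \<in> N \<inter> H" "m' = m \<otimes> w" "k = w \<otimes> k'"
    using factorisation_change[of m k m' k'] assms by blast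
  let ?s = "n \<oplus>\<^bsub>BN\<^esub> m" and ?t = "h' \<oplus>\<^bsub>BH\<^esub> k'"
  have s: "?s \<in> N" and t: "?t \<in> H"
    using N H by simp_all
  have "h \<oplus>\<^bsub>BH\<^esub> k = w \<otimes> (z \<otimes> ?t)"
    using z w H by (simp add: meet_pull_H)
  \<comment> \<open>Pulling out \<open>z\<close> before \<open>w\<close> gives the factors the same order as in the sum over \<open>H\<close>.\<close>
  moreover have "n' \<oplus>\<^bsub>BN\<^esub> m' = (?s \<otimes> w) \<otimes> z"
    using z w N by (simp add: meet_pull_N(1)) (simp add: meet_pull_N(2))
  ultimately show ?thesis
    using s t z(1) w(1) by (simp add: m_assoc)
qed

definition glued_add :: "'a \<Rightarrow> 'a \<Rightarrow> 'a" where
  "glued_add x y = (THE s. \<exists>n\<in>N. \<exists>h\<in>H. \<exists>m\<in>N. \<exists>k\<in>H.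
     x = n \<otimes> h \<and> y = m \<otimes> k \<and> s = (n \<oplus>\<^bsub>BN\<^esub> m) \<otimes> (h \<oplus>\<^bsub>BH\<^esub> k))"

lemma glued_add_eq:
  assumes "n \<in> N" "h \<in> H" "m \<in> N" "k \<in> H"
  shows "glued_add (n \<otimes> h) (m \<otimes> k) = (n \<oplus>\<^bsub>BN\<^esub> m) \<otimes> (h \<oplus>\<^bsub>BH\<^esub> k)"
  unfolding glued_add_def
proof (rule the_equality)
  fix s
  assume "\<exists>n'\<in>N. \<exists>h'\<in>H. \<exists>m'\<in>N. \<exists>k'\<in>H.
    n \<otimes> h = n' \<otimes> h' \<and> m \<otimes> k = m' \<otimes> k' \<and> s = (n' \<oplus>\<^bsub>BN\<^esub> m') \<otimes> (h' \<oplus>\<^bsub>BH\<^esub> k')"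
  then show "s = (n \<oplus>\<^bsub>BN\<^esub> m) \<otimes> (h \<oplus>\<^bsub>BH\<^esub> k)"
    using summand_product_unique assms by metis
qed (use assms in blast)

definition glued_brace :: "'a ring" where
  "glued_brace = \<lparr>carrier = carrier G, monoid.mult = (\<otimes>), one = \<one>, ring.zero = \<one>, add = glued_add\<rparr>"

lemma glued_brace_sel [simp]:
  "carrier glued_brace = carrier G"
  "x \<otimes>\<^bsub>glued_brace\<^esub> y = x \<otimes> y"
  "\<one>\<^bsub>glued_brace\<^esub> = \<one>"
  "\<zero>\<^bsub>glued_brace\<^esub> = \<one>"
  "x \<oplus>\<^bsub>glued_brace\<^esub> y = glued_add x y"
  by (simp_all add: glued_brace_def)

lemma product_map_hom:
  "(\<lambda>(n, h). n \<otimes> h) \<in> hom (add_monoid BN \<times>\<times> add_monoid BH) (add_monoid glued_brace)"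
  by (auto simp: hom_def carrier_N carrier_H glued_add_eq)

lemma product_map_onto:
  "(\<lambda>(n, h). n \<otimes> h) ` carrier (add_monoid BN \<times>\<times> add_monoid BH)
     = carrier (add_monoid glued_brace)"
  by (auto simp: carrier_N carrier_H image_iff elim: factorisation)

text \<open>
  No group axiom of the new addition needs checking by hand: it is the image of the direct product
  of the two additive groups under the product map.
\<close>

lemma glued_add_group: "group (add_monoid glued_brace)"
  using group.hom_imp_img_group[OF DirProd_group product_map_hom]
    skew_left_brace.add_group[OF brace_N] skew_left_brace.add_group[OF brace_H]
  unfolding product_map_onto by (simp add: zero_N zero_H)

lemma glued_uminus:
  assumes "n \<in> N" "h \<in> H"
  shows "\<ominus>\<^bsub>glued_brace\<^esub> (n \<otimes> h) = (\<ominus>\<^bsub>BN\<^esub> n) \<otimes> (\<ominus>\<^bsub>BH\<^esub> h)"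
  unfolding a_inv_def[of glued_brace]
  by (rule group.inv_equality[OF glued_add_group])
     (use assms in \<open>simp_all add: glued_add_eq zero_N zero_H\<close>)

text \<open>
  Moving \<open>h\<close> past an element \<open>q\<close> of \<open>N\<close> replaces \<open>q\<close> by its conjugate, after which the
  \<open>N\<close>-parts and the \<open>H\<close>-parts no longer interact.  Conjugation being additive, each
  part is an instance of the brace law of its own brace.
\<close>

lemma glued_distrib:
  assumes "x \<in> carrier G" "y \<in> carrier G" "w \<in> carrier G"
  shows "x \<otimes> glued_add y w =
    glued_add (glued_add (x \<otimes> y) (\<ominus>\<^bsub>glued_brace\<^esub> x)) (x \<otimes> w)"
proof -
  obtain n h where x: "n \<in> N" "h \<in> H" "x = n \<otimes> h"
    using assms(1) by (rule factorisation)
  obtain m k where y: "m \<in> N" "k \<in> H" "y = m \<otimes> k"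
    using assms(2) by (rule factorisation)
  obtain p l where w: "p \<in> N" "l \<in> H" "w = p \<otimes> l"
    using assms(3) by (rule factorisation)
  let ?c = "\<lambda>q. h \<otimes> q \<otimes> inv h"
  have push: "(n \<otimes> h) \<otimes> (q \<otimes> j) = (n \<otimes> ?c q) \<otimes> (h \<otimes> j)" if "q \<in> N" "j \<in> H" for q j
    using that x by (simp add: m_assoc) (simp add: m_assoc[symmetric])
  have "x \<otimes> glued_add y w = (n \<otimes> ?c (m \<oplus>\<^bsub>BN\<^esub> p)) \<otimes> (h \<otimes> (k \<oplus>\<^bsub>BH\<^esub> l))"
    using x y w by (simp add: glued_add_eq push)
  also have "\<dots> = ((n \<otimes> ?c m \<oplus>\<^bsub>BN\<^esub> (\<ominus>\<^bsub>BN\<^esub> n)) \<oplus>\<^bsub>BN\<^esub> n \<otimes> ?c p) \<otimes>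
      ((h \<otimes> k \<oplus>\<^bsub>BH\<^esub> (\<ominus>\<^bsub>BH\<^esub> h)) \<oplus>\<^bsub>BH\<^esub> h \<otimes> l)"
    using x y w by (simp only: conj_add brace_law_N brace_law_H conj_closed H_closed)
  also have "\<dots> = glued_add (glued_add (x \<otimes> y) (\<ominus>\<^bsub>glued_brace\<^esub> x)) (x \<otimes> w)"
    using x y w by (simp add: glued_add_eq push glued_uminus)
  finally show ?thesis .
qed

lemma glued_skew_left_brace: "skew_left_brace glued_brace"
proof (rule skew_left_brace.intro)
  show "group (add_monoid glued_brace)"
    by (rule glued_add_group)
  have "(\<lambda>x. x) \<in> iso G glued_brace"
    by (simp add: iso_def hom_def bij_betw_def)
  then show "group glued_brace"
    using iso_imp_img_group[of "\<lambda>x. x" glued_brace] by (simp add: glued_brace_def)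
qed (simp add: glued_distrib)

text \<open>
  Centralising \<open>N\<close> is what lets \<open>c\<close> pass \<open>m\<close> in \<open>(ac)(mk)\<close> without conjugating it; the rest
  happens inside \<open>N\<close> and \<open>H\<close> separately.
\<close>

lemma glued_soc:
  "brace_soc BN <#> centralizer G (brace_soc BH) N \<subseteq> brace_soc glued_brace"
proof
  interpret B: skew_left_brace glued_brace
    by (rule glued_skew_left_brace)
  fix x
  assume "x \<in> brace_soc BN <#> centralizer G (brace_soc BH) N"
  then obtain a c where x: "x = a \<otimes> c" and a: "a \<in> brace_soc BN" and c: "c \<in> brace_soc BH"
    and comm: "\<And>n. n \<in> N \<Longrightarrow> c \<otimes> n = n \<otimes> c"
    unfolding set_mult_def centralizer_def by blast
  have aN: "a \<in> N"
    and a_soc: "\<And>n. n \<in> N \<Longrightarrow> a \<otimes> n = a \<oplus>\<^bsub>BN\<^esub> n \<and> n \<oplus>\<^bsub>BN\<^esub> a = a \<oplus>\<^bsub>BN\<^esub> n"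
    using a unfolding soc_N_iff by metis+
  have cH: "c \<in> H"
    and c_soc: "\<And>h. h \<in> H \<Longrightarrow> c \<otimes> h = c \<oplus>\<^bsub>BH\<^esub> h \<and> h \<oplus>\<^bsub>BH\<^esub> c = c \<oplus>\<^bsub>BH\<^esub> h"
    using c unfolding soc_H_iff by metis+
  have "x \<otimes> y = glued_add x y \<and> glued_add x y = glued_add y x" if yG: "y \<in> carrier G" for y
  proof -
    obtain m k where y: "m \<in> N" "k \<in> H" "y = m \<otimes> k"
      using yG by (rule factorisation)
    have "x \<otimes> y = (a \<otimes> (c \<otimes> m)) \<otimes> k"
      using aN cH y x by (simp add: m_assoc)
    also have "\<dots> = (a \<otimes> m) \<otimes> (c \<otimes> k)"
      using aN cH y by (simp add: comm m_assoc)
    also have "\<dots> = (a \<oplus>\<^bsub>BN\<^esub> m) \<otimes> (c \<oplus>\<^bsub>BH\<^esub> k)"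
      using a_soc c_soc y by simp
    finally show ?thesis
      using a_soc c_soc aN cH x y by (simp add: glued_add_eq)
  qed
  then show "x \<in> brace_soc glued_brace"
    using x aN cH by (simp add: B.brace_soc_iff)
qed

lemma glued_add_N:
  assumes "n \<in> N" "m \<in> N" shows "glued_add n m = n \<oplus>\<^bsub>BN\<^esub> m"
  using glued_add_eq[of n \<one> m \<one>] assms BH.add.l_one[of \<one>] by (simp add: zero_H)

lemma glued_add_H:
  assumes "h \<in> H" "k \<in> H" shows "glued_add h k = h \<oplus>\<^bsub>BH\<^esub> k"
  using glued_add_eq[of \<one> h \<one> k] assms BN.add.l_one[of \<one>] by (simp add: zero_N)

lemma glued_uminus_N: "n \<in> N \<Longrightarrow> \<ominus>\<^bsub>glued_brace\<^esub> n = \<ominus>\<^bsub>BN\<^esub> n"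
  using glued_uminus[of n \<one>] BH.add.inv_one by (simp add: zero_H)

lemma glued_uminus_H: "h \<in> H \<Longrightarrow> \<ominus>\<^bsub>glued_brace\<^esub> h = \<ominus>\<^bsub>BH\<^esub> h"
  using glued_uminus[of \<one> h] BN.add.inv_one by (simp add: zero_N)

lemma glued_subbrace_N: "is_subbrace BN glued_brace"
proof -
  interpret B: skew_left_brace glued_brace
    by (rule glued_skew_left_brace)
  have "subgroup N (add_monoid glued_brace)"
    by (rule B.add.subgroupI) (use N_one in \<open>auto simp: glued_add_N glued_uminus_N\<close>)
  moreover have "subgroup N glued_brace"
    using subgroup_N unfolding subgroup_def m_inv_def by simp
  ultimately show ?thesis
    by (simp add: is_subbrace_def carrier_N mult_N glued_add_N)
qed

lemma glued_subbrace_H: "is_subbrace BH glued_brace"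
proof -
  interpret B: skew_left_brace glued_brace
    by (rule glued_skew_left_brace)
  have "subgroup H (add_monoid glued_brace)"
    by (rule B.add.subgroupI) (use H_one in \<open>auto simp: glued_add_H glued_uminus_H\<close>)
  moreover have "subgroup H glued_brace"
    using subgroup_H unfolding subgroup_def m_inv_def by simp
  ultimately show ?thesis
    by (simp add: is_subbrace_def carrier_H mult_H glued_add_H)
qed

end

theorem theorem5:
  fixes \<XX> :: "'u monoid \<Rightarrow> bool"
    and G :: "'a monoid"
    and N H :: "'a set"
    and BN BH :: "'a ring"
  assumes "infinite (UNIV :: 'u set)"
    and "group_class \<XX>"
    and "quotient_closed \<XX>"
    and "product_closed \<XX>"
    and "group G"
    and "N \<lhd> G"
    and "subgroup H G"
    and "carrier G = N <#>\<^bsub>G\<^esub> H"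
    and "N \<inter> H \<subseteq> center (G\<lparr>carrier := N\<rparr>)"
    and "associated_brace \<XX> (G\<lparr>carrier := N\<rparr>) BN"
    and "associated_brace \<XX> (G\<lparr>carrier := H\<rparr>) BH"
    and "N \<inter> H \<subseteq> brace_ker BN \<inter> brace_ker BH"
    and "N \<inter> H \<subseteq> center (add_monoid BN) \<inter> center (add_monoid BH)"
    and "equivariant_action (G\<lparr>carrier := H\<rparr>) BN (conj_action G N)"
  shows "XYB_group \<XX> G \<and>
    (\<exists>B :: 'a ring. associated_brace \<XX> G B \<and>
       brace_soc BN <#>\<^bsub>G\<^esub> centralizer G (brace_soc BH) N \<subseteq> brace_soc B \<and>
       is_subbrace BN B \<and> is_subbrace BH B)"
proof -
  have carr: "carrier BN = N" "carrier BH = H"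
    and mult: "\<And>x y. \<lbrakk>x \<in> N; y \<in> N\<rbrakk> \<Longrightarrow> x \<otimes>\<^bsub>BN\<^esub> y = x \<otimes>\<^bsub>G\<^esub> y"
      "\<And>x y. \<lbrakk>x \<in> H; y \<in> H\<rbrakk> \<Longrightarrow> x \<otimes>\<^bsub>BH\<^esub> y = x \<otimes>\<^bsub>G\<^esub> y"
    and braces: "skew_left_brace BN" "skew_left_brace BH"
    and types: "in_class \<XX> (add_monoid BN)" "in_class \<XX> (add_monoid BH)"
    using assms(10,11) unfolding associated_brace_def brace_of_type_def by auto
  interpret central_brace_product G N H BN BH
  proof (intro central_brace_product.intro central_brace_product_axioms.intro)
    fix h m p
    assume hmp: "h \<in> H" "m \<in> N" "p \<in> N"
    interpret BN: skew_left_brace BN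
      by (rule braces)
    have "conj_action G N h \<in> hom (add_monoid BN) (add_monoid BN)"
      using assms(14) hmp(1) unfolding equivariant_action_def auto_def by simp
    then have "conj_action G N h (m \<oplus>\<^bsub>BN\<^esub> p) =
        conj_action G N h m \<oplus>\<^bsub>BN\<^esub> conj_action G N h p"
      using hmp carr unfolding hom_def by simp
    then show "h \<otimes>\<^bsub>G\<^esub> (m \<oplus>\<^bsub>BN\<^esub> p) \<otimes>\<^bsub>G\<^esub> inv\<^bsub>G\<^esub> h =
        (h \<otimes>\<^bsub>G\<^esub> m \<otimes>\<^bsub>G\<^esub> inv\<^bsub>G\<^esub> h) \<oplus>\<^bsub>BN\<^esub> (h \<otimes>\<^bsub>G\<^esub> p \<otimes>\<^bsub>G\<^esub> inv\<^bsub>G\<^esub> h)"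
      using hmp carr BN.add.m_closed[of m p] unfolding conj_action_def by simp
  qed (use assms carr mult braces in \<open>auto simp: center_iff brace_soc_def\<close>)
  have "in_class \<XX> (add_monoid glued_brace)"
    using in_class_epi_image[OF assms(2,3) _ product_map_hom product_map_onto glued_add_group]
      in_class_DirProd[OF assms(1,2,4) types] by blast
  then have "associated_brace \<XX> G glued_brace"
    by (simp add: associated_brace_def brace_of_type_def glued_skew_left_brace)
  then show ?thesis
    using associated_brace_imp_XYB_group[OF assms(5)] glued_soc glued_subbrace_N glued_subbrace_H
    by blast
qed

end
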